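(* Let $g:\mathbb{R}\to\mathbb{R}$ be measurable and square integrable, and for $0\le k\le n$ let $Y_n\left(S^n_k,\frac{k}{n}\right)=\mathbb{E}_{Q_n}\left[\left.\frac{\beta_k^n}{\beta_n^n}g(S_n^n)\,\right|\,\mathcal{F}_k^n\right]$. Then for $0\le k\le n-1$, $$Y_n\left(S_k^n,\tfrac{k}{n}\right)=\tilde{\pi}(\omega_1;S_k^n)\,Y_n\left(S_{k+1}^n(\omega_1),\tfrac{k+1}{n}\right)+\tilde{\pi}(\omega_2;S_k^n)\,Y_n\left(S_{k+1}^n(\omega_2),\tfrac{k+1}{n}\right).$$
   Context: Let $b,r$ be continuous real functions of $S$ with $r\ge0$, $|x^2r(x)|\le K(1+x^2)$ for some constant $K>0$; let $\sigma(S,t)$ be a bounded Borel function bounded below by a positive constant; let $\lambda(S,t)$ be nonnegative, bounded and continuous; $b(S)$, $\lambda(S,t)S$, $\sigma(S,t)S$ are Lipschitz in $S$, uniformly in $t\in[0,1]$. Put $\theta(S,t)=-\dfrac{b(S)-r(S)S}{\sigma(S,t)S}$ for $S>0$; $\theta$ is assumed bounded. Let $\bar\Omega_n=\{\omega_1,\omega_2\}^n$ with $P_n$ the product of the measures giving mass $1/2$ to each of $\omega_1,\omega_2$; $\varepsilon^k$ ($k=1,\dots,n$) depends on the $k$-th coordinate only and equals $1$ on $\omega_1$ and $-1$ on $\omega_2$; $\mathcal{F}_k^n=\sigma(\varepsilon^1,\dots,\varepsilon^k)$. Set $S_0^n=S_0>0$, $B_0^n=1$, and $$S_{k+1}^n=S_k^n+\frac{b(S_k^n)+\lambda(S_k^n,\frac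 kn)S_k^n}{n}+\frac{\sigma(S_k^n,\frac kn)S_k^n}{\sqrt n}\varepsilon^{k+1},\qquad B_{k+1}^n=B_k^n\Big(1+\frac{r(S_k^n)}n\Big).$$ $S_{k+1}^n(\omega_1)$ and $S_{k+1}^n(\omega_2)$ denote the values of $S_{k+1}^n$ given $S_k^n$ when $\varepsilon^{k+1}=1$ and $\varepsilon^{k+1}=-1$ respectively. Let $\xi_0^n=1$, $\xi_{k+1}^n=\xi_k^n\big(1+\frac{\theta(S_k^n,k/n)}{\sqrt n}\varepsilon^{k+1}\big)$, and $dQ_n=\xi_n^n\,dP_n$; $n$ is taken large enough that $S_k^n>0$ and $|\theta|<\sqrt n$, so that $Q_n$ is a probability measure. Hazard process: $\Gamma_k^n=\sum_{i=0}^{k-1}\frac1n\lambda(S_i^n,\frac in)$. Auxiliary discount process: $\beta_k^n=B_k^ne^{\Gamma_k^n}=\prod_{i=0}^{k-1}\big(1+\frac{\tilde r_i}{n}\big)$, where $\tilde r_k$ is defined by $1+\frac{\tilde r_k}{n}=\big(1+\frac{r(S_k^n)}{n}\big)\exp\big(\frac{\lambda(S_k^n,k/n)}{n}\big)$. The defaultable state prices are $$\tilde\pi(\omega_s;S_k^n)=\frac12\Big(1+\frac{\theta(S_k^n,k/n)}{\sqrt n}\varepsilon^{k+1}(\omega_s)\Big)\Big(1+\frac{\tilde r_k}{n}\Big)^{-1},\qquad s=1,2,$$ where $\varepsilon^{k+1}(\omega_1)=1$, $\varepsilon^{k+1}(\omega_2)=-1$. *)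

theory Defs
  imports "HOL-Probability.Probability"
begin

text \<open>
  The one-period states are \<open>\<omega>1\<close>, \<open>\<omega>2\<close>; a path is an extensional function on \<open>{1..n}\<close>, so that
  the coordinate \<open>k\<close> carries the same index as \<open>\<epsilon> k\<close>.
\<close>

datatype state = \<omega>1 | \<omega>2

fun sign :: "state \<Rightarrow> real" where
  "sign \<omega>1 = 1"
| "sign \<omega>2 = -1"

definition \<epsilon> :: "nat \<Rightarrow> (nat \<Rightarrow> state) \<Rightarrow> real" where
  "\<epsilon> k \<omega> = sign (\<omega> k)"

definition path_measure :: "nat \<Rightarrow> (nat \<Rightarrow> state) measure" where
  "path_measure n = (\<Pi>\<^sub>M i\<in>{1..n}. uniform_count_measure UNIV)"

definition path_filtration :: "nat \<Rightarrow> nat \<Rightarrow> (nat \<Rightarrow> state) measure" where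
  "path_filtration n k = sigma (space (path_measure n))
     {\<epsilon> i -` A \<inter> space (path_measure n) | i A. i \<in> {1..k} \<and> A \<in> sets borel}"

text \<open>
  Throughout, \<open>b\<close> is the drift, \<open>r\<close> the interest rate, \<open>\<sigma>\<close> the volatility, \<open>lam\<close> the default
  intensity and \<open>S0\<close> the initial stock price. The second argument of \<open>\<sigma>\<close> and \<open>lam\<close> is time.
\<close>

context
  fixes b r :: "real \<Rightarrow> real"
    and \<sigma> lam :: "real \<Rightarrow> real \<Rightarrow> real"
    and S0 :: real
    and n :: nat
begin

definition \<theta> :: "real \<Rightarrow> real \<Rightarrow> real" where
  "\<theta> s t = - ((b s - r s * s) / (\<sigma> s t * s))"

text \<open>\<open>stock_succ k s w\<close> is the value of $S_{k+1}^n$ given $S_k^n = s$ when the next state is \<open>w\<close>.\<close>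

definition stock_succ :: "nat \<Rightarrow> real \<Rightarrow> state \<Rightarrow> real" where
  "stock_succ k s w =
     s + (b s + lam s (real k / real n) * s) / real n
       + \<sigma> s (real k / real n) * s / sqrt (real n) * sign w"

primrec stock :: "nat \<Rightarrow> (nat \<Rightarrow> state) \<Rightarrow> real" where
  "stock 0 \<omega> = S0"
| "stock (Suc k) \<omega> =
     stock k \<omega>
     + (b (stock k \<omega>) + lam (stock k \<omega>) (real k / real n) * stock k \<omega>) / real n
     + \<sigma> (stock k \<omega>) (real k / real n) * stock k \<omega> / sqrt (real n) * \<epsilon> (Suc k) \<omega>"

lemma stock_Suc_eq_stock_succ:
  "stock (Suc k) \<omega> = stock_succ k (stock k \<omega>) (\<omega> (Suc k))"
  by (simp add: stock_succ_def \<epsilon>_def)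

primrec bank :: "nat \<Rightarrow> (nat \<Rightarrow> state) \<Rightarrow> real" where
  "bank 0 \<omega> = 1"
| "bank (Suc k) \<omega> = bank k \<omega> * (1 + r (stock k \<omega>) / real n)"

primrec \<xi> :: "nat \<Rightarrow> (nat \<Rightarrow> state) \<Rightarrow> real" where
  "\<xi> 0 \<omega> = 1"
| "\<xi> (Suc k) \<omega> =
     \<xi> k \<omega> * (1 + \<theta> (stock k \<omega>) (real k / real n) / sqrt (real n) * \<epsilon> (Suc k) \<omega>)"

definition pricing_measure :: "(nat \<Rightarrow> state) measure" where
  "pricing_measure = density (path_measure n) (\<lambda>\<omega>. ennreal (\<xi> n \<omega>))"

definition hazard :: "nat \<Rightarrow> (nat \<Rightarrow> state) \<Rightarrow> real" where
  "hazard k \<omega> = (\<Sum>i<k. 1 / real n * lam (stock i \<omega>) (real i / real n))"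

definition \<beta> :: "nat \<Rightarrow> (nat \<Rightarrow> state) \<Rightarrow> real" where
  "\<beta> k \<omega> = bank k \<omega> * exp (hazard k \<omega>)"

text \<open>
  \<open>rate_tilde k s\<close> is the solution $\tilde r$ of
  $1 + \tilde r / n = (1 + r(s)/n) \exp(\lambda(s, k/n)/n)$.
\<close>

definition rate_tilde :: "nat \<Rightarrow> real \<Rightarrow> real" where
  "rate_tilde k s =
     real n * ((1 + r s / real n) * exp (lam s (real k / real n) / real n) - 1)"

definition state_price :: "nat \<Rightarrow> state \<Rightarrow> real \<Rightarrow> real" where
  "state_price k w s =
     1 / 2 * (1 + \<theta> s (real k / real n) / sqrt (real n) * sign w)
       * inverse (1 + rate_tilde k s / real n)"

text \<open>
  \<open>Y\<close> is only pinned down at the nodes of the tree. Conditional expectations are defined up to null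
  sets, but when $\xi^n_n > 0$ every path has positive mass, so the equation holds for every path.
\<close>

definition is_value_function :: "(real \<Rightarrow> real) \<Rightarrow> (real \<Rightarrow> real \<Rightarrow> real) \<Rightarrow> bool" where
  "is_value_function g Y \<longleftrightarrow>
     (\<forall>k\<le>n. AE \<omega> in pricing_measure.
        Y (stock k \<omega>) (real k / real n) =
          real_cond_exp pricing_measure (path_filtration n k)
            (\<lambda>\<omega>. \<beta> k \<omega> / \<beta> n \<omega> * g (stock n \<omega>)) \<omega>)"

end

end

theory Submission
  imports Defs
begin

text \<open>
  All of the probability lives on a finite set of equally likely paths. Backward induction through
  the tree defines a candidate value \<open>V k s\<close>. Averaging over the sign of the next
  coordinate shows that the discounted candidate, weighted by the density \<open>\<xi>\<close>, has constant
  integral over each event of \<open>\<F>\<^sub>k\<close>, so the candidate is a version of the conditional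
  expectation. Since \<open>\<bar>\<theta>\<bar> < \<surd>n\<close>, every path has positive mass; hence any value function agrees
  with the candidate at every node and inherits its recursion.
\<close>

section \<open>The path space as a finite set of equally likely paths\<close>

text \<open>A product measure is determined by its values on boxes, and on a box both sides reduce
  to the same product of ratios \<open>card (B i) / card (A i)\<close>. This turns integrals over
  paths into finite averages.\<close>

lemma PiM_uniform_count_measure:
  assumes "finite I" and fin: "\<And>i. finite (A i)"
  shows "(\<Pi>\<^sub>M i\<in>I. uniform_count_measure (A i)) = uniform_count_measure (PiE I A)"
proof -
  have "finite_measure (uniform_count_measure (A i))" for i
    by (rule finite_measureI)
       (simp add: space_uniform_count_measure emeasure_uniform_count_measure fin)
  then interpret product_sigma_finite "\<lambda>i. uniform_count_measure (A i)"
    by (simp add: product_sigma_finite_def finite_measure.axioms(1))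
  have finP: "finite (PiE I A)"
    using assms by (simp add: finite_PiE)
  have "uniform_count_measure (PiE I A) = (\<Pi>\<^sub>M i\<in>I. uniform_count_measure (A i))"
  proof (rule PiM_eqI)
    have "sets (\<Pi>\<^sub>M i\<in>I. uniform_count_measure (A i)) = sets (\<Pi>\<^sub>M i\<in>I. count_space (A i))"
      by (intro sets_PiM_cong) (auto simp: sets_uniform_count_measure)
    also have "\<dots> = Pow (PiE I A)"
      using assms by (simp add: count_space_PiM_finite countable_finite)
    finally show "sets (uniform_count_measure (PiE I A))
        = sets (\<Pi>\<^sub>M i\<in>I. uniform_count_measure (A i))"
      by (simp add: sets_uniform_count_measure)
  next
    fix B assume "\<And>i. i \<in> I \<Longrightarrow> B i \<in> sets (uniform_count_measure (A i))"
    then have B: "\<And>i. i \<in> I \<Longrightarrow> B i \<subseteq> A i"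
      by (simp add: sets_uniform_count_measure)
    have "emeasure (uniform_count_measure (PiE I A)) (PiE I B)
        = ennreal (\<Prod>i\<in>I. real (card (B i)) / real (card (A i)))"
      using assms B finP
      by (simp add: emeasure_uniform_count_measure PiE_mono card_PiE prod_dividef)
    also have "\<dots> = (\<Prod>i\<in>I. emeasure (uniform_count_measure (A i)) (B i))"
      using B fin by (simp add: prod_ennreal emeasure_uniform_count_measure)
    finally show "emeasure (uniform_count_measure (PiE I A)) (PiE I B)
        = (\<Prod>i\<in>I. emeasure (uniform_count_measure (A i)) (B i))" .
  qed fact
  then show ?thesis by simp
qed

lemma UNIV_state: "UNIV = {\<omega>1, \<omega>2}"
  using state.exhaust by auto

lemma path_measure_eq_uniform:
  "path_measure n = uniform_count_measure (PiE {1..n} (\<lambda>_. UNIV))"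
  unfolding path_measure_def by (rule PiM_uniform_count_measure) (simp_all add: UNIV_state)

lemma space_path_measure: "space (path_measure n) = PiE {1..n} (\<lambda>_. UNIV)"
  by (simp add: path_measure_eq_uniform space_uniform_count_measure)

lemma sets_path_measure: "sets (path_measure n) = Pow (space (path_measure n))"
  by (simp add: path_measure_eq_uniform space_uniform_count_measure sets_uniform_count_measure)

lemma finite_space_path_measure: "finite (space (path_measure n))"
  by (simp add: space_path_measure finite_PiE UNIV_state)

lemma measurable_path_measure: "f \<in> borel_measurable (path_measure n)"
  by (simp add: measurable_def sets_path_measure)

text \<open>Each path has the same positive mass, the path space being finite and nonempty, so only
  the empty set is null.\<close>

lemma AE_path_measure: "(AE p in path_measure n. P p) \<longleftrightarrow> (\<forall>p\<in>space (path_measure n). P p)"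
proof -
  have "card (space (path_measure n)) > 0"
    using finite_space_path_measure by (simp add: card_gt_0_iff space_path_measure PiE_eq_empty_iff)
  then show ?thesis
    unfolding path_measure_eq_uniform uniform_count_measure_def AE_point_measure
    by (simp add: space_point_measure)
qed

lemma integral_path_measure:
  fixes f :: "(nat \<Rightarrow> state) \<Rightarrow> real"
  shows "integral\<^sup>L (path_measure n) f
    = (\<Sum>p\<in>space (path_measure n). f p) / card (space (path_measure n))"
  using finite_space_path_measure[of n]
  by (simp add: path_measure_eq_uniform space_uniform_count_measure integral_uniform_count_measure)

lemma integrable_path_measure:
  fixes f :: "(nat \<Rightarrow> state) \<Rightarrow> real"
  shows "integrable (path_measure n) f"
  unfolding path_measure_eq_uniform uniform_count_measure_def
  by (rule integrable_point_measure_finite)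
     (use finite_space_path_measure in \<open>simp add: space_path_measure\<close>)

section \<open>Averaging over one coordinate\<close>

lemma fun_upd_in_space_path_measure:
  "p \<in> space (path_measure n) \<Longrightarrow> j \<in> {1..n} \<Longrightarrow> p(j := w) \<in> space (path_measure n)"
  by (auto simp: space_path_measure PiE_iff extensional_def)

fun flip :: "state \<Rightarrow> state" where
  "flip \<omega>1 = \<omega>2"
| "flip \<omega>2 = \<omega>1"

lemma flip_flip [simp]: "flip (flip w) = w"
  by (cases w) auto

text \<open>Flipping coordinate \<open>j\<close> is an involution of the path space, so it leaves
  the sum unchanged. A path and its flip are, in some order, the two updates of that path at
  \<open>j\<close>.\<close>

lemma sum_paths_average_coordinate:
  fixes f :: "(nat \<Rightarrow> state) \<Rightarrow> real"
  assumes "j \<in> {1..n}"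
  shows "(\<Sum>p\<in>space (path_measure n). f p)
    = (\<Sum>p\<in>space (path_measure n). (f (p(j := \<omega>1)) + f (p(j := \<omega>2))) / 2)"
proof -
  have "(\<Sum>p\<in>space (path_measure n). f p)
      = (\<Sum>p\<in>space (path_measure n). f (p(j := flip (p j))))"
    by (rule sum.reindex_bij_witness[where i = "\<lambda>p. p(j := flip (p j))"
          and j = "\<lambda>p. p(j := flip (p j))"])
       (simp_all add: fun_upd_in_space_path_measure[OF _ assms])
  then have "(\<Sum>p\<in>space (path_measure n). f p)
      = (\<Sum>p\<in>space (path_measure n). (f p + f (p(j := flip (p j)))) / 2)"
    by (simp add: sum.distrib flip: sum_divide_distrib)
  moreover have "f p + f (p(j := flip (p j))) = f (p(j := \<omega>1)) + f (p(j := \<omega>2))" for p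
    by (cases "p j") (simp_all add: fun_upd_idem)
  ultimately show ?thesis by simp
qed

section \<open>Dependence on a prefix and the filtration\<close>

text \<open>A pointwise form of measurability with respect to \<open>path_filtration n k\<close>,
  convenient for induction along the recursions. The value type is left free so that membership in
  an event is covered as well.\<close>

definition determined_by_prefix :: "nat \<Rightarrow> nat \<Rightarrow> ((nat \<Rightarrow> state) \<Rightarrow> 'a) \<Rightarrow> bool" where
  "determined_by_prefix n k f \<longleftrightarrow>
     (\<forall>p\<in>space (path_measure n). \<forall>p'\<in>space (path_measure n).
        (\<forall>i\<in>{1..k}. p i = p' i) \<longrightarrow> f p = f p')"

lemma determined_by_prefixD:
  "\<lbrakk>determined_by_prefix n k f; p \<in> space (path_measure n); p' \<in> space (path_measure n);
    \<And>i. i \<in> {1..k} \<Longrightarrow> p i = p' i\<rbrakk> \<Longrightarrow> f p = f p'"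
  unfolding determined_by_prefix_def by blast

lemma determined_by_prefixI:
  "(\<And>p p'. \<lbrakk>p \<in> space (path_measure n); p' \<in> space (path_measure n);
      \<And>i. i \<in> {1..k} \<Longrightarrow> p i = p' i\<rbrakk> \<Longrightarrow> f p = f p') \<Longrightarrow> determined_by_prefix n k f"
  unfolding determined_by_prefix_def by blast

lemma determined_by_prefix_comp2:
  assumes "determined_by_prefix n k f" "determined_by_prefix n k g"
  shows "determined_by_prefix n k (\<lambda>p. F (f p) (g p))"
proof (rule determined_by_prefixI)
  fix p p' assume p: "p \<in> space (path_measure n)" "p' \<in> space (path_measure n)"
    and eq: "\<And>i. i \<in> {1..k} \<Longrightarrow> p i = p' i"
  show "F (f p) (g p) = F (f p') (g p')"
    using determined_by_prefixD[OF assms(1) p eq] determined_by_prefixD[OF assms(2) p eq] by simp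
qed

text \<open>The update leaves coordinates 1 to \<open>k\<close> untouched. Quantities known at time
  \<open>k\<close> can thus be taken out of an average over coordinate \<open>Suc k\<close>.\<close>

lemma determined_by_prefix_fun_upd:
  assumes f: "determined_by_prefix n k f" and p: "p \<in> space (path_measure n)" and k: "k < n"
  shows "f (p(Suc k := w)) = f p"
  using k by (intro determined_by_prefixD[OF f fun_upd_in_space_path_measure[OF p] p]) simp_all

lemma determined_by_prefix_mono:
  "determined_by_prefix n k f \<Longrightarrow> k \<le> m \<Longrightarrow> determined_by_prefix n m f"
  unfolding determined_by_prefix_def by (meson atLeastAtMost_iff order_trans)

lemma space_path_filtration: "space (path_filtration n k) = space (path_measure n)"
  unfolding path_filtration_def by (rule space_measure_of) auto

lemma sets_path_filtration:
  "sets (path_filtration n k) = sigma_sets (space (path_measure n))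
     {\<epsilon> i -` A \<inter> space (path_measure n) | i A. i \<in> {1..k} \<and> A \<in> sets borel}"
  unfolding path_filtration_def by (rule sets_measure_of) auto

lemma subalgebra_path_filtration: "subalgebra (path_measure n) (path_filtration n k)"
  unfolding subalgebra_def
  using sets.sets_into_space[of _ "path_filtration n k"]
  by (auto simp: space_path_filtration sets_path_measure)

text \<open>Generators have the property, and it survives complements and countable unions.\<close>

lemma path_filtration_imp_determined:
  assumes "A \<in> sets (path_filtration n k)"
  shows "determined_by_prefix n k (\<lambda>p. p \<in> A)"
  using assms unfolding sets_path_filtration
proof (induction rule: sigma_sets.induct)
  case (Basic a)
  then obtain i B where "i \<in> {1..k}" "a = \<epsilon> i -` B \<inter> space (path_measure n)"
    by blast
  then show ?case
    by (intro determined_by_prefixI) (simp add: \<epsilon>_def)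
next
  case (Compl a)
  show ?case
  proof (rule determined_by_prefixI)
    fix p p' assume p: "p \<in> space (path_measure n)" "p' \<in> space (path_measure n)"
      and eq: "\<And>i. i \<in> {1..k} \<Longrightarrow> p i = p' i"
    show "p \<in> space (path_measure n) - a \<longleftrightarrow> p' \<in> space (path_measure n) - a"
      using determined_by_prefixD[OF Compl.IH p eq] p by simp
  qed
next
  case (Union a)
  show ?case
  proof (rule determined_by_prefixI)
    fix p p' assume p: "p \<in> space (path_measure n)" "p' \<in> space (path_measure n)"
      and eq: "\<And>i. i \<in> {1..k} \<Longrightarrow> p i = p' i"
    show "p \<in> (\<Union>i. a i) \<longleftrightarrow> p' \<in> (\<Union>i. a i)"
      using determined_by_prefixD[OF Union.IH p eq] by simp
  qed
qed (simp add: determined_by_prefix_def)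

text \<open>Injectivity lets the variables \<epsilon>, which generate the filtration, recover the
  coordinates themselves.\<close>

lemma sign_eq_iff: "sign v = sign w \<longleftrightarrow> v = w"
  by (cases v; cases w) auto

text \<open>A cylinder is a finite intersection of generators, each the preimage of the singleton
  \<open>{sign (p i)}\<close>.\<close>

lemma cylinder_in_path_filtration:
  "{p' \<in> space (path_measure n). \<forall>i\<in>{1..k}. p' i = p i} \<in> sets (path_filtration n k)"
proof -
  have "{p' \<in> space (path_filtration n k). p' i = p i} \<in> sets (path_filtration n k)"
    if "i \<in> {1..k}" for i
  proof -
    have "{sign (p i)} \<in> sets borel" by simp
    with that have "\<epsilon> i -` {sign (p i)} \<inter> space (path_measure n) \<in> sets (path_filtration n k)"
      unfolding sets_path_filtration by (intro sigma_sets.Basic CollectI exI conjI) (rule refl)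
    also have "\<epsilon> i -` {sign (p i)} \<inter> space (path_measure n)
        = {p' \<in> space (path_filtration n k). p' i = p i}"
      by (auto simp: \<epsilon>_def sign_eq_iff space_path_filtration)
    finally show ?thesis .
  qed
  then have "{p' \<in> space (path_filtration n k). \<forall>i\<in>{1..k}. p' i = p i} \<in> sets (path_filtration n k)"
    by (intro sets.sets_Collect_finite_All) simp_all
  then show ?thesis
    by (simp add: space_path_filtration)
qed

lemma measurable_path_filtration:
  assumes "determined_by_prefix n k f"
  shows "f \<in> borel_measurable (path_filtration n k)"
proof (rule measurableI)
  fix A
  define B where "B = f -` A \<inter> space (path_measure n)"
  \<comment> \<open>With any path, the preimage contains all paths sharing its prefix, so it is a
    union of cylinders, finite because there are finitely many paths.\<close>
  have "B = (\<Union>p\<in>B. {p' \<in> space (path_measure n). \<forall>i\<in>{1..k}. p' i = p i})"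
  proof (intro set_eqI iffI)
    fix p' assume "p' \<in> (\<Union>p\<in>B. {p' \<in> space (path_measure n). \<forall>i\<in>{1..k}. p' i = p i})"
    then obtain p where p: "p \<in> B" "p' \<in> space (path_measure n)" "\<forall>i\<in>{1..k}. p' i = p i"
      by blast
    then have "f p' = f p"
      using assms unfolding B_def determined_by_prefix_def by blast
    with p show "p' \<in> B"
      by (simp add: B_def)
  qed (auto simp: B_def)
  moreover have "finite B"
    unfolding B_def using finite_space_path_measure by blast
  then have "(\<Union>p\<in>B. {p' \<in> space (path_measure n). \<forall>i\<in>{1..k}. p' i = p i})
      \<in> sets (path_filtration n k)"
    by (rule sets.finite_UN) (rule cylinder_in_path_filtration)
  ultimately have "B \<in> sets (path_filtration n k)"
    by (rule ssubst)
  then show "f -` A \<inter> space (path_filtration n k) \<in> sets (path_filtration n k)"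
    by (simp add: B_def space_path_filtration)
qed simp

section \<open>The market processes along a path\<close>

locale binomial_market =
  fixes b r :: "real \<Rightarrow> real"
    and \<sigma> lam :: "real \<Rightarrow> real \<Rightarrow> real"
    and S0 :: real
    and n :: nat
  assumes r_nonneg: "\<And>x. r x \<ge> 0"
    and n_pos: "n \<ge> 1"
    and stock_pos: "\<And>k p. k \<le> n \<Longrightarrow> p \<in> space (path_measure n) \<Longrightarrow> stock b \<sigma> lam S0 n k p > 0"
    and \<theta>_less: "\<And>x t. x > 0 \<Longrightarrow> t \<in> {0..1} \<Longrightarrow> \<bar>\<theta> b r \<sigma> x t\<bar> < sqrt (real n)"
begin

abbreviation "\<Omega> \<equiv> space (path_measure n)"
abbreviation "S \<equiv> stock b \<sigma> lam S0 n"
abbreviation "S_next \<equiv> stock_succ b \<sigma> lam n"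
abbreviation "Z \<equiv> \<xi> b r \<sigma> lam S0 n"
abbreviation "D \<equiv> \<beta> b r \<sigma> lam S0 n"
abbreviation "Q \<equiv> pricing_measure b r \<sigma> lam S0 n"

text \<open>The one-step transition probability under \<open>Q\<close> at price \<open>s\<close>.
  Twice this number is the factor that \<open>Z\<close> gains; divided by the one-period discount
  factor it is the state price.\<close>

definition q :: "nat \<Rightarrow> real \<Rightarrow> state \<Rightarrow> real" where
  "q k s w = 1 / 2 * (1 + \<theta> b r \<sigma> s (real k / real n) / sqrt (real n) * sign w)"

lemma S_determined: "determined_by_prefix n k (S k)"
proof (induction k)
  case (Suc k)
  show ?case
  proof (rule determined_by_prefixI)
    fix p p' assume "p \<in> \<Omega>" "p' \<in> \<Omega>" and eq: "\<And>i. i \<in> {1..Suc k} \<Longrightarrow> p i = p' i"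
    then have "S k p = S k p'"
      by (intro determined_by_prefixD[OF Suc]) simp_all
    then show "S (Suc k) p = S (Suc k) p'"
      using eq[of "Suc k"] by (simp add: stock_Suc_eq_stock_succ del: stock.simps)
  qed
qed (simp add: determined_by_prefix_def)

lemma Z_Suc: "Z (Suc k) p = Z k p * (2 * q k (S k p) (p (Suc k)))"
  by (simp add: q_def \<epsilon>_def)

lemma Z_determined: "determined_by_prefix n k (Z k)"
proof (induction k)
  case (Suc k)
  show ?case
  proof (rule determined_by_prefixI)
    fix p p' assume p: "p \<in> \<Omega>" "p' \<in> \<Omega>" and eq: "\<And>i. i \<in> {1..Suc k} \<Longrightarrow> p i = p' i"
    have "S k p = S k p'"
      by (rule determined_by_prefixD[OF S_determined p]) (simp add: eq)
    moreover have "Z k p = Z k p'"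
      by (rule determined_by_prefixD[OF Suc p]) (simp add: eq)
    ultimately show "Z (Suc k) p = Z (Suc k) p'"
      using eq[of "Suc k"] by (simp add: Z_Suc del: \<xi>.simps)
  qed
qed (simp add: determined_by_prefix_def)

lemma D_Suc: "D (Suc k) p = D k p * (1 + rate_tilde r lam n k (S k p) / real n)"
  using n_pos by (simp add: \<beta>_def rate_tilde_def hazard_def exp_add)

text \<open>Discounting is predictable: the rate for the period after time \<open>k\<close> is fixed
  by \<open>S k\<close>, so \<open>D (Suc k)\<close> is already known at time
  \<open>k\<close>.\<close>

lemma D_Suc_determined_if:
  assumes "determined_by_prefix n k (D k)"
  shows "determined_by_prefix n k (D (Suc k))"
  unfolding D_Suc by (rule determined_by_prefix_comp2[OF assms S_determined])

lemma D_determined: "determined_by_prefix n k (D k)"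
proof (induction k)
  case (Suc k)
  then show ?case
    by (intro determined_by_prefix_mono[OF D_Suc_determined_if]) simp_all
qed (simp add: determined_by_prefix_def \<beta>_def hazard_def)

lemmas D_Suc_determined = D_Suc_determined_if[OF D_determined]

lemma D_pos: "D k p > 0"
proof -
  have "bank b r \<sigma> lam S0 n k p > 0"
    using r_nonneg by (induction k) (auto intro!: mult_pos_pos add_pos_nonneg)
  then show ?thesis
    by (simp add: \<beta>_def)
qed

text \<open>At a positive price \<theta> lies strictly between -\<surd>n and \<surd>n, so both
  one-step probabilities are positive and \<open>Z\<close> is a product of positive factors.\<close>

lemma Z_pos: "k \<le> n \<Longrightarrow> p \<in> \<Omega> \<Longrightarrow> Z k p > 0"
proof (induction k)
  case (Suc k)
  have "\<bar>\<theta> b r \<sigma> (S k p) (real k / real n)\<bar> < sqrt (real n)"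
    using Suc.prems by (intro \<theta>_less stock_pos) auto
  then have "\<bar>\<theta> b r \<sigma> (S k p) (real k / real n) / sqrt (real n)\<bar> < 1"
    using n_pos by (simp add: divide_simps)
  then have "q k (S k p) (p (Suc k)) > 0"
    unfolding q_def abs_less_iff by (cases "p (Suc k)") simp_all
  then show ?case
    using Suc by (simp add: Z_Suc del: \<xi>.simps)
qed simp

section \<open>Density-weighted sums and backward induction\<close>

text \<open>This is one-step conditioning under \<open>Q\<close>, written as a finite sum. Averaging
  over coordinate \<open>Suc k\<close> freezes \<open>h\<close>, \<open>S k\<close> and
  \<open>Z k\<close>; the 2 in each factor \<open>2 * q\<close> cancels the 1/2 of the
  average.\<close>

lemma sum_Z_step:
  assumes h: "determined_by_prefix n k h" and k: "k < n"
  shows "(\<Sum>p\<in>\<Omega>. h p * Z (Suc k) p * F (S k p) (p (Suc k)))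
    = (\<Sum>p\<in>\<Omega>. h p * Z k p *
        (q k (S k p) \<omega>1 * F (S k p) \<omega>1 + q k (S k p) \<omega>2 * F (S k p) \<omega>2))"
proof -
  have "Suc k \<in> {1..n}" using k by simp
  note average = sum_paths_average_coordinate[OF this]
  show ?thesis
    unfolding average[of "\<lambda>p. h p * Z (Suc k) p * F (S k p) (p (Suc k))"]
  proof (rule sum.cong)
    fix p assume p: "p \<in> \<Omega>"
    note upd = determined_by_prefix_fun_upd[OF _ p k]
    show "(h (p(Suc k := \<omega>1)) * Z (Suc k) (p(Suc k := \<omega>1))
            * F (S k (p(Suc k := \<omega>1))) ((p(Suc k := \<omega>1)) (Suc k))
          + h (p(Suc k := \<omega>2)) * Z (Suc k) (p(Suc k := \<omega>2))
            * F (S k (p(Suc k := \<omega>2))) ((p(Suc k := \<omega>2)) (Suc k))) / 2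
        = h p * Z k p *
          (q k (S k p) \<omega>1 * F (S k p) \<omega>1 + q k (S k p) \<omega>2 * F (S k p) \<omega>2)"
      by (simp add: Z_Suc upd[OF h] upd[OF S_determined] upd[OF Z_determined] algebra_simps
          del: \<xi>.simps)
  qed simp
qed

lemma q_sum: "q k s \<omega>1 + q k s \<omega>2 = 1"
  by (simp add: q_def algebra_simps)

text \<open>The density process is a martingale under the path measure, so against a weight known at
  time \<open>k\<close> its terminal value may be replaced by \<open>Z k\<close>.\<close>

lemma sum_Z_n:
  assumes h: "determined_by_prefix n k h" and k: "k \<le> n"
  shows "(\<Sum>p\<in>\<Omega>. h p * Z n p) = (\<Sum>p\<in>\<Omega>. h p * Z k p)"
  using k h
proof (induction rule: inc_induct)
  case (step m)
  have "(\<Sum>p\<in>\<Omega>. h p * Z n p) = (\<Sum>p\<in>\<Omega>. h p * Z (Suc m) p)"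
    by (rule step.IH[OF determined_by_prefix_mono[OF step.prems]]) simp
  also have "\<dots> = (\<Sum>p\<in>\<Omega>. h p * Z m p)"
    \<comment> \<open>For the constant payoff 1 the one-step average is the sum of the two
      probabilities, which is 1.\<close>
    using sum_Z_step[OF step.prems step.hyps(2), of "\<lambda>_ _. 1"]
    by (simp add: q_sum del: \<xi>.simps)
  finally show ?case .
qed simp

text \<open>The first argument counts the periods that remain, so it is \<open>n - k\<close> at time \<open>k\<close>.\<close>

primrec tree_value :: "(real \<Rightarrow> real) \<Rightarrow> nat \<Rightarrow> real \<Rightarrow> real" where
  "tree_value g 0 s = g s"
| "tree_value g (Suc m) s =
     state_price b r \<sigma> lam n (n - Suc m) \<omega>1 s * tree_value g m (S_next (n - Suc m) s \<omega>1)
   + state_price b r \<sigma> lam n (n - Suc m) \<omega>2 s * tree_value g m (S_next (n - Suc m) s \<omega>2)"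

definition V :: "(real \<Rightarrow> real) \<Rightarrow> nat \<Rightarrow> real \<Rightarrow> real" where
  "V g k s = tree_value g (n - k) s"

lemma V_n: "V g n s = g s"
  by (simp add: V_def)

lemma V_step:
  assumes "k < n"
  shows "V g k s =
     state_price b r \<sigma> lam n k \<omega>1 s * V g (Suc k) (S_next k s \<omega>1)
   + state_price b r \<sigma> lam n k \<omega>2 s * V g (Suc k) (S_next k s \<omega>2)"
proof -
  have "n - k = Suc (n - Suc k)" and "n - Suc (n - Suc k) = k"
    using assms by simp_all
  then show ?thesis
    by (simp add: V_def)
qed

text \<open>Backward induction from time \<open>n\<close>: \<open>V / D\<close> is a martingale
  under \<open>Q\<close>, because the state prices are the probabilities \<open>q\<close> discounted
  over one period.\<close>

lemma sum_discounted_V: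
  assumes h: "determined_by_prefix n k h" and k: "k \<le> n"
  shows "(\<Sum>p\<in>\<Omega>. h p * Z n p / D n p * g (S n p))
    = (\<Sum>p\<in>\<Omega>. h p * Z k p / D k p * V g k (S k p))"
  using k h
proof (induction rule: inc_induct)
  case base
  then show ?case by (simp add: V_n)
next
  case (step m)
  let ?F = "\<lambda>s w. V g (Suc m) (S_next m s w)"
  have "(\<Sum>p\<in>\<Omega>. h p * Z n p / D n p * g (S n p))
      = (\<Sum>p\<in>\<Omega>. h p / D (Suc m) p * Z (Suc m) p * ?F (S m p) (p (Suc m)))"
    unfolding step.IH[OF determined_by_prefix_mono[OF step.prems le_SucI[OF order_refl]]]
    by (simp add: stock_Suc_eq_stock_succ del: \<xi>.simps stock.simps)
  \<comment> \<open>Predictability of \<open>D\<close> makes \<open>h / D (Suc m)\<close> an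
    admissible weight at time \<open>m\<close>.\<close>
  also have "\<dots> = (\<Sum>p\<in>\<Omega>. h p / D (Suc m) p * Z m p *
        (q m (S m p) \<omega>1 * ?F (S m p) \<omega>1 + q m (S m p) \<omega>2 * ?F (S m p) \<omega>2))"
    by (rule sum_Z_step[OF determined_by_prefix_comp2[OF step.prems D_Suc_determined, of "(/)"]
          step.hyps(2)])
  also have "\<dots> = (\<Sum>p\<in>\<Omega>. h p * Z m p / D m p * V g m (S m p))"
  proof -
    \<comment> \<open>Here \<open>c\<close> is the one-period discount factor; moving it inside the
      average turns each \<open>q\<close> into a state price.\<close>
    have "x / (d * c) * z * (a * u + a' * v) = x * z / d * (a * inverse c * u + a' * inverse c * v)"
      for x d c z a a' u v :: real
      by (simp add: divide_inverse algebra_simps)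
    then show ?thesis
      unfolding V_step[OF step.hyps(2)] state_price_def q_def[symmetric] D_Suc
      by (intro sum.cong refl)
  qed
  finally show ?case .
qed

section \<open>Conditional expectation under the pricing measure\<close>

lemma space_Q: "space Q = \<Omega>" and sets_Q: "sets Q = sets (path_measure n)"
  by (simp_all add: pricing_measure_def)

text \<open>The density is positive on every path, so \<open>Q\<close> too has only the empty null
  set.\<close>

lemma AE_Q: "(AE p in Q. P p) \<longleftrightarrow> (\<forall>p\<in>\<Omega>. P p)"
  unfolding pricing_measure_def
  using Z_pos by (simp add: AE_density measurable_path_measure AE_path_measure)

lemma Z_n_nonneg: "AE p in path_measure n. 0 \<le> Z n p"
  using Z_pos by (simp add: AE_path_measure less_imp_le)

lemma integral_Q:
  fixes f :: "(nat \<Rightarrow> state) \<Rightarrow> real"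
  shows "integral\<^sup>L Q f = (\<Sum>p\<in>\<Omega>. Z n p * f p) / card \<Omega>"
  unfolding pricing_measure_def
  by (simp add: integral_real_density measurable_path_measure Z_n_nonneg integral_path_measure)

lemma integrable_Q:
  fixes f :: "(nat \<Rightarrow> state) \<Rightarrow> real"
  shows "integrable Q f"
  unfolding pricing_measure_def
  by (simp add: integrable_real_density measurable_path_measure Z_n_nonneg integrable_path_measure)

text \<open>The candidate is known at time \<open>k\<close> and has the right integral over each
  event of \<open>path_filtration n k\<close>, so it is a version of the conditional expectation.
  Equality almost everywhere under \<open>Q\<close> is equality on every path.\<close>

lemma cond_exp_eq_V:
  assumes k: "k \<le> n" and p: "p \<in> \<Omega>"
  shows "real_cond_exp Q (path_filtration n k) (\<lambda>p. D k p / D n p * g (S n p)) p = V g k (S k p)"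
proof -
  have "integrable Q (\<lambda>_. 1 :: real)"
    by (rule integrable_Q)
  then have "(\<integral>\<^sup>+ p. ennreal (norm (1 :: real)) \<partial>Q) < \<infinity>"
    unfolding integrable_iff_bounded by blast
  then have "finite_measure Q"
    by (intro finite_measureI) simp
  moreover have "subalgebra Q (path_filtration n k)"
    using subalgebra_path_filtration[of n k] by (simp add: subalgebra_def space_Q sets_Q)
  ultimately interpret finite_measure_subalgebra Q "path_filtration n k"
    by (simp add: finite_measure_subalgebra_def finite_measure_subalgebra_axioms_def)
  have V_det: "determined_by_prefix n k (\<lambda>p. V g k (S k p))"
    by (rule determined_by_prefix_comp2[OF S_determined S_determined])
  have "AE p in Q. real_cond_exp Q (path_filtration n k) (\<lambda>p. D k p / D n p * g (S n p)) p
      = V g k (S k p)"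
  proof (rule real_cond_exp_charact)
    fix A assume "A \<in> sets (path_filtration n k)"
    then have A: "determined_by_prefix n k (\<lambda>p. p \<in> A)"
      by (rule path_filtration_imp_determined)
    \<comment> \<open>The numerator \<open>D k\<close> joins the indicator in the weight, to cancel
      against the \<open>D k\<close> that backward induction leaves in the denominator.\<close>
    have hD: "determined_by_prefix n k (\<lambda>p. indicator A p * D k p)"
      unfolding indicator_def by (rule determined_by_prefix_comp2[OF A D_determined])
    have hV: "determined_by_prefix n k (\<lambda>p. indicator A p * V g k (S k p))"
      unfolding indicator_def by (rule determined_by_prefix_comp2[OF A V_det])
    have "(\<Sum>p\<in>\<Omega>. Z n p * (indicator A p * (D k p / D n p * g (S n p))))
        = (\<Sum>p\<in>\<Omega>. indicator A p * D k p * Z n p / D n p * g (S n p))"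
      by (simp add: ac_simps)
    also have "\<dots> = (\<Sum>p\<in>\<Omega>. indicator A p * D k p * Z k p / D k p * V g k (S k p))"
      by (rule sum_discounted_V[OF hD k])
    also have "\<dots> = (\<Sum>p\<in>\<Omega>. indicator A p * V g k (S k p) * Z k p)"
      using D_pos[of k] by (intro sum.cong) (auto simp: less_imp_neq[symmetric])
    \<comment> \<open>The martingale property, read backwards, restores the terminal density that
      integration under \<open>Q\<close> requires.\<close>
    also have "\<dots> = (\<Sum>p\<in>\<Omega>. indicator A p * V g k (S k p) * Z n p)"
      by (rule sum_Z_n[OF hV k, symmetric])
    finally show "(\<integral>p\<in>A. (D k p / D n p * g (S n p)) \<partial>Q) = (\<integral>p\<in>A. V g k (S k p) \<partial>Q)"
      by (simp add: set_lebesgue_integral_def integral_Q ac_simps)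
  qed (simp_all add: integrable_Q measurable_path_filtration V_det)
  then show ?thesis
    using p by (simp add: AE_Q)
qed

section \<open>Value functions and their recursion\<close>

lemma is_value_function_iff:
  "is_value_function b r \<sigma> lam S0 n g Y \<longleftrightarrow>
     (\<forall>k\<le>n. \<forall>p\<in>\<Omega>. Y (S k p) (real k / real n) = V g k (S k p))"
  by (simp add: is_value_function_def AE_Q cond_exp_eq_V del: times_divide_eq_left)

lemma value_function_exists: "\<exists>Y. is_value_function b r \<sigma> lam S0 n g Y"
proof
  \<comment> \<open>Rounding \<open>t * real n\<close> down recovers the index \<open>k\<close> from
    the time \<open>t = k / n\<close>.\<close>
  show "is_value_function b r \<sigma> lam S0 n g (\<lambda>s t. V g (nat \<lfloor>t * real n\<rfloor>) s)"
    using n_pos by (simp add: is_value_function_iff)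
qed

lemma value_function_step:
  assumes Y: "is_value_function b r \<sigma> lam S0 n g Y" and k: "k < n" and p: "p \<in> \<Omega>"
  shows "Y (S k p) (real k / real n) =
      state_price b r \<sigma> lam n k \<omega>1 (S k p) * Y (S_next k (S k p) \<omega>1) (real (k + 1) / real n)
    + state_price b r \<sigma> lam n k \<omega>2 (S k p) * Y (S_next k (S k p) \<omega>2) (real (k + 1) / real n)"
proof -
  \<comment> \<open>Both successors must be nodes of the tree for \<open>Y\<close> to be pinned
    there. The one off the path \<open>p\<close> is reached by resetting coordinate
    \<open>Suc k\<close>.\<close>
  have "Y (S_next k (S k p) w) (real (k + 1) / real n) = V g (Suc k) (S_next k (S k p) w)" for w
  proof -
    have "S (Suc k) (p(Suc k := w)) = S_next k (S k p) w"
      unfolding stock_Suc_eq_stock_succ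
      by (simp add: determined_by_prefix_fun_upd[OF S_determined p k])
    moreover have "p(Suc k := w) \<in> \<Omega>"
      using p k by (simp add: fun_upd_in_space_path_measure)
    ultimately show ?thesis
      using Y k unfolding is_value_function_iff by (metis Suc_eq_plus1 Suc_leI)
  qed
  then show ?thesis
    using Y k p by (simp add: is_value_function_iff V_step[OF k])
qed

end

text \<open>The existence conjunct keeps the recursion, which is claimed for every value function,
  from holding vacuously.\<close>

theorem lemma3p1:
  fixes b r :: "real \<Rightarrow> real"
    and \<sigma> lam :: "real \<Rightarrow> real \<Rightarrow> real"
    and S0 :: real
    and n :: nat
    and g :: "real \<Rightarrow> real"
  assumes "continuous_on UNIV b"
    and "continuous_on UNIV r"
    and "\<And>x. r x \<ge> 0"
    and "\<exists>K>0. \<forall>x. \<bar>x\<^sup>2 * r x\<bar> \<le> K * (1 + x\<^sup>2)"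
    and "(\<lambda>(x, t). \<sigma> x t) \<in> borel_measurable (restrict_space borel (UNIV \<times> {0..1}))"
    and "\<exists>M. \<forall>x. \<forall>t\<in>{0..1}. \<bar>\<sigma> x t\<bar> \<le> M"
    and "\<exists>c>0. \<forall>x. \<forall>t\<in>{0..1}. c \<le> \<sigma> x t"
    and "continuous_on (UNIV \<times> {0..1}) (\<lambda>(x, t). lam x t)"
    and "\<And>x t. t \<in> {0..1} \<Longrightarrow> lam x t \<ge> 0"
    and "\<exists>M. \<forall>x. \<forall>t\<in>{0..1}. \<bar>lam x t\<bar> \<le> M"
    and "\<exists>L. L-lipschitz_on UNIV b"
    and "\<exists>L. \<forall>t\<in>{0..1}. L-lipschitz_on UNIV (\<lambda>x. lam x t * x)"
    and "\<exists>L. \<forall>t\<in>{0..1}. L-lipschitz_on UNIV (\<lambda>x. \<sigma> x t * x)"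
    and "\<exists>M. \<forall>x>0. \<forall>t\<in>{0..1}. \<bar>\<theta> b r \<sigma> x t\<bar> \<le> M"
    and "S0 > 0"
    and "n \<ge> 1"
    and "\<forall>k\<le>n. \<forall>\<omega>\<in>space (path_measure n). stock b \<sigma> lam S0 n k \<omega> > 0"
    and "\<forall>x>0. \<forall>t\<in>{0..1}. \<bar>\<theta> b r \<sigma> x t\<bar> < sqrt (real n)"
    and "g \<in> borel_measurable borel"
    and "integrable (distr (pricing_measure b r \<sigma> lam S0 n) borel (stock b \<sigma> lam S0 n n))
           (\<lambda>x. (g x)\<^sup>2)"
  shows "(\<exists>Y. is_value_function b r \<sigma> lam S0 n g Y) \<and>
    (\<forall>Y. is_value_function b r \<sigma> lam S0 n g Y \<longrightarrow>
      (\<forall>k<n. \<forall>\<omega>\<in>space (path_measure n).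
        let s = stock b \<sigma> lam S0 n k \<omega>;
            t' = real (k + 1) / real n
        in Y s (real k / real n) =
             state_price b r \<sigma> lam n k \<omega>1 s * Y (stock_succ b \<sigma> lam n k s \<omega>1) t'
           + state_price b r \<sigma> lam n k \<omega>2 s * Y (stock_succ b \<sigma> lam n k s \<omega>2) t'))"
proof -
  interpret binomial_market b r \<sigma> lam S0 n
    using assms(3,16-18) by unfold_locales auto
  show ?thesis
    using value_function_exists value_function_step unfolding Let_def by blast
qed

end
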